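(* Let $F = (F_1,\dots,F_n) : \mathbb{R}^n \to \mathbb{R}^n$ be a payment-free Shapley operator, i.e. a monotone, additively homogeneous and positively homogeneous operator. Then $F$ can be represented as $$F_i(x) = \min_{a \in A_i} \; \max_{b \in B_{i,a}} \; \sum_{j=1}^n P_{ij}^{ab} x_j , \quad \forall x \in \mathbb{R}^n,\ \forall i \in \{1,\dots,n\},$$ where: $A_i = \{ a \in \mathbb{R}^n \mid F_i(a) = 0 \}$; for every $i \in \{1,\dots,n\}$ and every $a \in A_i$, $B_{i,a}$ is a finite subset of $\mathbb{R}^n$; and for every $i \in \{1,\dots,n\}$, every $a \in A_i$ and every $b \in B_{i,a}$, $P_i^{ab} = (P_{ij}^{ab})_{1 \leq j \leq n}$ is a stochastic vector with at most two positive coordinates.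
   Context: $\mathbb{R}^n$ is equipped with the standard (coordinatewise) partial order, and $e$ denotes the vector with all entries equal to $1$. An operator $F : \mathbb{R}^n \to \mathbb{R}^n$ is monotone if $x \leq y$ implies $F(x) \leq F(y)$; additively homogeneous if $F(\lambda e + x) = \lambda e + F(x)$ for all $\lambda \in \mathbb{R}$, $x \in \mathbb{R}^n$; positively homogeneous if $F(\lambda x) = \lambda F(x)$ for all $\lambda \geq 0$, $x \in \mathbb{R}^n$. A stochastic vector is a vector with nonnegative coordinates summing to $1$. Writing $\min$ and $\max$ means that the extrema are attained. *)

theory Defs
  imports "HOL-Analysis.Analysis"
begin

text \<open>The order on \<^typ>\<open>real ^ 'n\<close> is the coordinatewise one (\<open>less_eq_vec_def\<close>), and
  \<^term>\<open>1 :: real ^ 'n\<close> is the vector with all entries equal to one (\<open>one_vec_def\<close>).\<close>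

definition additively_homogeneous :: "(real ^ 'n \<Rightarrow> real ^ 'n) \<Rightarrow> bool" where
  "additively_homogeneous F \<longleftrightarrow>
     (\<forall>(l::real) x. F (l *\<^sub>R 1 + x) = l *\<^sub>R 1 + F x)"

definition positively_homogeneous :: "(real ^ 'n \<Rightarrow> real ^ 'n) \<Rightarrow> bool" where
  "positively_homogeneous F \<longleftrightarrow>
     (\<forall>(l::real) x. l \<ge> 0 \<longrightarrow> F (l *\<^sub>R x) = l *\<^sub>R F x)"

definition payment_free_shapley_operator :: "(real ^ 'n \<Rightarrow> real ^ 'n) \<Rightarrow> bool" where
  "payment_free_shapley_operator F \<longleftrightarrow>
     mono F \<and> additively_homogeneous F \<and> positively_homogeneous F"

definition stochastic_vector :: "real ^ 'n \<Rightarrow> bool" where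
  "stochastic_vector p \<longleftrightarrow> (\<forall>j. p $ j \<ge> 0) \<and> (\<Sum>j\<in>UNIV. p $ j) = 1"

text \<open>\<open>Min\<close> is only meaningful on finite sets and \<open>Inf\<close> need not be attained, so an attained
  minimum \<open>m\<close> over a possibly infinite family is expressed relationally. In particular the
  index set is then nonempty.\<close>

definition is_min_over :: "'a set \<Rightarrow> ('a \<Rightarrow> real) \<Rightarrow> real \<Rightarrow> bool" where
  "is_min_over A f m \<longleftrightarrow> (\<exists>a\<in>A. f a = m) \<and> (\<forall>a\<in>A. m \<le> f a)"

end

theory Submission
  imports Defs
begin

text \<open>
  Fix a coordinate \<open>i\<close> and a zero \<open>a\<close> of \<open>F\<^sub>i\<close>. Homogeneity gives
  \<open>F\<^sub>i (t e + \<lambda> a) = t\<close> for all \<open>t\<close> and all \<open>\<lambda> \<ge> 0\<close>, so by monotonicity \<open>F\<^sub>i\<close> lies below the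
  sublinear function
  \<open>g\<^sub>a x = min {t. \<exists>\<lambda>\<ge>0. x \<le> t e + \<lambda> a}\<close>.
  This function touches \<open>F\<^sub>i\<close> along \<open>{t e + \<lambda> a}\<close>. Since every \<open>x\<close> is of the form \<open>t e + a\<close>, with
  \<open>t = F\<^sub>i x\<close> and \<open>a = x - F\<^sub>i x e\<close> a zero of \<open>F\<^sub>i\<close>, the operator \<open>F\<^sub>i\<close> is the attained minimum of
  the functions \<open>g\<^sub>a\<close>.

  By linear programming duality, \<open>g\<^sub>a x\<close> is the maximum of \<open>p \<bullet> x\<close> over the polytope of stochastic
  vectors \<open>p\<close> with \<open>p \<bullet> a \<le> 0\<close>. That polytope is the simplex cut by one half-space, so each of its
  vertices is either a vertex of the simplex or the crossing of an edge of the simplex with the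
  hyperplane \<open>p \<bullet> a = 0\<close>; in particular it has at most two positive coordinates. These vertices
  are the actions of the maximizer. The inequality \<open>g\<^sub>a x \<le> max p \<bullet> x\<close> of this duality is
  \<open>exists_multiplier_if_vertices_bounded\<close>, which gives \<open>F\<^sub>i x \<le> max p \<bullet> x\<close> for every zero \<open>a\<close>
  (\<open>shapley_le_Max_vertices\<close>); equality at \<open>a = x - F\<^sub>i x e\<close> follows from \<open>p \<bullet> a \<le> 0\<close>.
\<close>

text \<open>
  For \<open>a\<^sub>j < 0 < a\<^sub>k\<close>, this is the point where the edge of the simplex from \<open>axis j 1\<close> to
  \<open>axis k 1\<close> meets the hyperplane orthogonal to \<open>a\<close>.
\<close>

definition edge_crossing :: "real ^ 'n \<Rightarrow> 'n \<Rightarrow> 'n \<Rightarrow> real ^ 'n" where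
  "edge_crossing a j k =
     (a $ k / (a $ k - a $ j)) *\<^sub>R axis j 1 + (- a $ j / (a $ k - a $ j)) *\<^sub>R axis k 1"

text \<open>The vertices of the polytope of stochastic vectors \<open>p\<close> with \<open>p \<bullet> a \<le> 0\<close>.\<close>

definition halfspace_vertices :: "real ^ 'n \<Rightarrow> (real ^ 'n) set" where
  "halfspace_vertices a =
     {axis j 1 | j. a $ j \<le> 0} \<union> {edge_crossing a j k | j k. a $ j < 0 \<and> 0 < a $ k}"

lemma halfspace_vertices_cases:
  assumes "p \<in> halfspace_vertices a"
  obtains (vertex) j where "a $ j \<le> 0" "p = axis j 1"
    | (crossing) j k where "a $ j < 0" "0 < a $ k" "p = edge_crossing a j k"
  using assms unfolding halfspace_vertices_def by blast

lemma finite_halfspace_vertices: "finite (halfspace_vertices (a :: real ^ 'n))"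
proof -
  have "halfspace_vertices a
      \<subseteq> range (\<lambda>j. axis j 1) \<union> range (\<lambda>(j, k). edge_crossing a j k)"
    unfolding halfspace_vertices_def by auto
  then show ?thesis
    by (rule finite_subset) simp
qed

lemma inner_edge_crossing:
  "edge_crossing a j k \<bullet> x = (a $ k * x $ j - a $ j * x $ k) / (a $ k - a $ j)"
  unfolding edge_crossing_def
  by (simp add: inner_diff_left inner_axis' diff_divide_distrib)

lemma stochastic_vector_alt:
  "stochastic_vector p \<longleftrightarrow> 0 \<le> p \<and> p \<bullet> 1 = 1"
  unfolding stochastic_vector_def less_eq_vec_def inner_vec_def by simp

lemma halfspace_vertices_stochastic:
  assumes "p \<in> halfspace_vertices a"
  shows "stochastic_vector p"
  using assms
proof (cases rule: halfspace_vertices_cases)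
  case (vertex j)
  then show ?thesis
    by (simp add: stochastic_vector_alt inner_axis' less_eq_vec_def) (simp add: axis_def)
next
  case (crossing j k)
  then have "0 \<le> p"
    by (simp add: edge_crossing_def less_eq_vec_def axis_def divide_nonpos_pos)
  moreover have "p \<bullet> 1 = 1"
    using crossing by (simp add: inner_edge_crossing)
  ultimately show ?thesis
    by (simp add: stochastic_vector_alt)
qed

lemma halfspace_vertices_card_support:
  assumes "p \<in> halfspace_vertices a"
  shows "card {j. p $ j > 0} \<le> 2"
  using assms
proof (cases rule: halfspace_vertices_cases)
  case (vertex j)
  then have "{l. p $ l > 0} \<subseteq> {j}"
    by (auto simp: axis_def split: if_splits)
  then have "card {l. p $ l > 0} \<le> card {j}"
    by (intro card_mono) simp_all
  then show ?thesis by simp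
next
  case (crossing j k)
  then have "{l. p $ l > 0} \<subseteq> {j, k}"
    by (auto simp: edge_crossing_def axis_def split: if_splits)
  then have "card {l. p $ l > 0} \<le> card {j, k}"
    by (intro card_mono) simp_all
  also have "\<dots> \<le> 2"
    by (simp add: card_insert_if)
  finally show ?thesis .
qed

lemma halfspace_vertices_inner_nonpos:
  assumes "p \<in> halfspace_vertices a"
  shows "p \<bullet> a \<le> 0"
  using assms
  by (cases rule: halfspace_vertices_cases) (simp_all add: inner_axis' inner_edge_crossing)

text \<open>
  For \<open>a\<^sub>k > 0\<close> the inequality \<open>x\<^sub>k \<le> M + \<lambda> a\<^sub>k\<close> is a lower bound on \<open>\<lambda>\<close>, for
  \<open>a\<^sub>j < 0\<close> it is an upper bound. The simplex vertices bound \<open>x\<^sub>j\<close> by \<open>M\<close>, which makes the upper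
  bounds nonnegative and settles the entries with \<open>a\<^sub>j = 0\<close>; the edge crossings make each lower
  bound at most each upper bound. Hence the largest of \<open>0\<close> and the lower bounds works.
\<close>

lemma exists_multiplier_if_vertices_bounded:
  fixes a x :: "real ^ 'n"
  assumes bound: "\<And>p. p \<in> halfspace_vertices a \<Longrightarrow> p \<bullet> x \<le> M"
  shows "\<exists>l\<ge>0. x \<le> M *\<^sub>R 1 + l *\<^sub>R a"
proof -
  have vertex: "x $ j \<le> M" if "a $ j \<le> 0" for j
    using bound[of "axis j 1"] that by (auto simp: halfspace_vertices_def inner_axis')
  have crossing: "(x $ k - M) / a $ k \<le> (M - x $ j) / (- a $ j)"
    if "a $ j < 0" "0 < a $ k" for j k
  proof -
    have "(a $ k * x $ j - a $ j * x $ k) / (a $ k - a $ j) \<le> M"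
      using bound[of "edge_crossing a j k"] that
      by (auto simp: halfspace_vertices_def inner_edge_crossing)
    then have "a $ k * x $ j - a $ j * x $ k \<le> M * (a $ k - a $ j)"
      using that by (simp add: pos_divide_le_eq)
    then have "(x $ k - M) * (- a $ j) \<le> (M - x $ j) * a $ k"
      by (simp add: algebra_simps)
    moreover have "0 < - a $ j"
      using that by simp
    ultimately show ?thesis
      using that(2) by (simp only: pos_divide_le_eq times_divide_eq_left pos_le_divide_eq)
  qed
  define L where "L = insert 0 ((\<lambda>k. (x $ k - M) / a $ k) ` {k. 0 < a $ k})"
  have "finite L"
    unfolding L_def by simp
  have "x $ j \<le> M + Max L * a $ j" for j
  proof (cases "a $ j" "0 :: real" rule: linorder_cases)
    case less
    have "Max L \<in> L"
      using \<open>finite L\<close> by (intro Max_in) (auto simp: L_def)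
    then have "Max L \<le> (M - x $ j) / (- a $ j)"
      using less vertex[of j] crossing[of j]
      by (auto simp: L_def divide_nonneg_neg)
    then show ?thesis
      using less by (simp add: field_simps)
  next
    case equal
    then show ?thesis
      using vertex[of j] by simp
  next
    case greater
    then have "(x $ j - M) / a $ j \<le> Max L"
      using \<open>finite L\<close> by (intro Max_ge) (auto simp: L_def)
    then show ?thesis
      using greater by (simp add: field_simps)
  qed
  moreover have "0 \<le> Max L"
    using \<open>finite L\<close> by (intro Max_ge) (auto simp: L_def)
  ultimately show ?thesis
    by (auto simp: less_eq_vec_def)
qed

context
  fixes F :: "real ^ 'n \<Rightarrow> real ^ 'n"
  assumes F: "payment_free_shapley_operator F"
begin

lemma shapley_mono_nth: "x \<le> y \<Longrightarrow> F x $ i \<le> F y $ i"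
  using F by (auto simp: payment_free_shapley_operator_def mono_def less_eq_vec_def)

lemma shapley_translate_scale_nth:
  assumes "0 \<le> l"
  shows "F (t *\<^sub>R 1 + l *\<^sub>R a) $ i = t + l * F a $ i"
  using F assms
  by (simp add: payment_free_shapley_operator_def additively_homogeneous_def
      positively_homogeneous_def)

text \<open>A vector with positive entries dominates \<open>\<epsilon> e\<close> for some \<open>\<epsilon> > 0\<close>, hence has a positive value.\<close>

lemma shapley_zero_has_nonpos_entry:
  assumes "F a $ i = 0"
  shows "\<exists>j. a $ j \<le> 0"
proof (rule ccontr)
  assume "\<not> (\<exists>j. a $ j \<le> 0)"
  then have pos: "0 < a $ j" for j
    by (simp add: not_le)
  define m where "m = Min (range (($) a))"
  have "0 < m"
    using pos unfolding m_def by (subst Min_gr_iff) auto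
  have "m *\<^sub>R 1 + 0 *\<^sub>R a \<le> a"
    unfolding m_def by (simp add: less_eq_vec_def)
  then have "F (m *\<^sub>R 1 + 0 *\<^sub>R a) $ i \<le> F a $ i"
    by (rule shapley_mono_nth)
  then show False
    using \<open>0 < m\<close> assms by (simp only: shapley_translate_scale_nth)
qed

lemma halfspace_vertices_nonempty:
  assumes "F a $ i = 0"
  shows "halfspace_vertices a \<noteq> {}"
  using shapley_zero_has_nonpos_entry[OF assms] by (auto simp: halfspace_vertices_def)

lemma shapley_le_Max_vertices:
  assumes "F a $ i = 0"
  shows "F x $ i \<le> Max ((\<lambda>p. p \<bullet> x) ` halfspace_vertices a)" (is "_ \<le> ?M")
proof -
  have "p \<bullet> x \<le> ?M" if "p \<in> halfspace_vertices a" for p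
    using that finite_halfspace_vertices by (intro Max_ge) auto
  then obtain l where "0 \<le> l" and l: "x \<le> ?M *\<^sub>R 1 + l *\<^sub>R a"
    using exists_multiplier_if_vertices_bounded by blast
  have "F x $ i \<le> F (?M *\<^sub>R 1 + l *\<^sub>R a) $ i"
    using l by (rule shapley_mono_nth)
  also have "\<dots> = ?M"
    using \<open>0 \<le> l\<close> assms by (simp add: shapley_translate_scale_nth)
  finally show ?thesis .
qed

text \<open>
  The minimum is attained at \<open>a = x - F\<^sub>i x e\<close>: there \<open>p \<bullet> x = p \<bullet> a + F\<^sub>i x\<close> for stochastic \<open>p\<close>,
  and \<open>p \<bullet> a \<le> 0\<close> for every vertex \<open>p\<close>.
\<close>

lemma shapley_is_min_over_Max_vertices:
  "is_min_over {a. F a $ i = 0} (\<lambda>a. Max ((\<lambda>p. p \<bullet> x) ` halfspace_vertices a)) (F x $ i)"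
proof -
  define a where "a = (- F x $ i) *\<^sub>R 1 + 1 *\<^sub>R x"
  have zero: "F a $ i = 0"
    unfolding a_def by (subst shapley_translate_scale_nth) auto
  have "p \<bullet> x \<le> F x $ i" if p: "p \<in> halfspace_vertices a" for p
  proof -
    have "p \<bullet> 1 = 1"
      using halfspace_vertices_stochastic[OF p] by (simp add: stochastic_vector_alt)
    then have "p \<bullet> x = p \<bullet> a + F x $ i"
      unfolding a_def by (simp add: inner_add_right inner_diff_right)
    then show ?thesis
      using halfspace_vertices_inner_nonpos[OF p] by simp
  qed
  then have "Max ((\<lambda>p. p \<bullet> x) ` halfspace_vertices a) \<le> F x $ i"
    using finite_halfspace_vertices halfspace_vertices_nonempty[OF zero] by (subst Max_le_iff) auto
  then show ?thesis
    unfolding is_min_over_def using shapley_le_Max_vertices zero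
    by (auto intro!: bexI[of _ a] antisym)
qed

end

theorem corollary4p3:
  fixes F :: "real ^ 'n \<Rightarrow> real ^ 'n"
    and A :: "'n \<Rightarrow> (real ^ 'n) set"
  assumes "payment_free_shapley_operator F"
    and A_eq: "\<And>i. A i = {a. F a $ i = 0}"
  shows "\<exists>(B :: 'n \<Rightarrow> real ^ 'n \<Rightarrow> (real ^ 'n) set)
            (P :: 'n \<Rightarrow> real ^ 'n \<Rightarrow> real ^ 'n \<Rightarrow> real ^ 'n).
           (\<forall>i. \<forall>a\<in>A i. finite (B i a) \<and> B i a \<noteq> {}) \<and>
           (\<forall>i. \<forall>a\<in>A i. \<forall>b\<in>B i a.
              stochastic_vector (P i a b) \<and> card {j. P i a b $ j > 0} \<le> 2) \<and>
           (\<forall>x i. is_min_over (A i)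
              (\<lambda>a. Max ((\<lambda>b. \<Sum>j\<in>UNIV. P i a b $ j * x $ j) ` B i a)) (F x $ i))"
proof -
  define B :: "'n \<Rightarrow> real ^ 'n \<Rightarrow> (real ^ 'n) set" where "B = (\<lambda>_. halfspace_vertices)"
  define P :: "'n \<Rightarrow> real ^ 'n \<Rightarrow> real ^ 'n \<Rightarrow> real ^ 'n" where "P = (\<lambda>_ _ p. p)"
  have "is_min_over (A i)
      (\<lambda>a. Max ((\<lambda>b. \<Sum>j\<in>UNIV. P i a b $ j * x $ j) ` B i a)) (F x $ i)" for x i
    using shapley_is_min_over_Max_vertices[OF assms(1), of i x]
    by (simp add: A_eq B_def P_def inner_vec_def)
  moreover have "finite (B i a) \<and> B i a \<noteq> {}" if "a \<in> A i" for i a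
    using that finite_halfspace_vertices halfspace_vertices_nonempty[OF assms(1)]
    by (simp add: A_eq B_def)
  moreover have "stochastic_vector (P i a b) \<and> card {j. P i a b $ j > 0} \<le> 2"
    if "b \<in> B i a" for i a b
    using that halfspace_vertices_stochastic halfspace_vertices_card_support
    unfolding B_def P_def by blast
  ultimately show ?thesis
    by blast
qed

end
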